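(* Let $q$ be a positive integer, let $R(n)$ denote the number of rich words of length $n$ over an alphabet with $q$ letters, let $\lambda\in\mathbb{R}$ with $\frac12<\lambda<1$, let $\gamma\in\mathbb{R}$ with $\gamma>1$, and let $\phi\in\Phi$. Then there exist $n_0\in\mathbb{N}_1$ and $c\in\mathbb{R}$ with $c>0$ such that, defining for $n\in\mathbb{N}_1$ \[ f(n)=\sqrt[\gamma]{c\,\ln^*\!\Big(\frac{n}{\phi(n)}\ln q\Big)}\qquad\text{and}\qquad B(n)=q^{\frac{n}{\phi(n)}+\frac{n}{(2\lambda)^{f(n)-1}}}, \] we have $R(n)\le B(n)$ for all $n\in\mathbb{N}_1$ with $n>n_0$, and $\lim_{n\to\infty}\sqrt[n]{B(n)}\le 1$.
   Context: A finite word $w=w_1\cdots w_n$ is a palindrome if $w=w_n\cdots w_1$; $w$ is called rich if it contains exactly $|w|$ distinct non-empty palindromic factors (equivalently, $|w|$ is attained as the number of its distinct non-empty palindromic factors). $\mathbb{N}_1$ is the set of positive integers, $\mathbb{R}_1=\{x\in\mathbb{R}: x\ge 1\}$. $\Delta$ is the set of functions $\phi:\mathbb{R}_1\to\mathbb{R}_1$ with $\lim_{x\to\infty}\phi(x)=\infty$, and $\Phi=\{\phi\in\Delta : \lim_{x\to\infty} x/\phi(x)=\infty\}$. The iterated logarithm is defined for real $x$ by $\ln^*(x)=0$ if $x\le 1$ and $\ln^*(x)=1+\ln^*(\ln x)$ otherwise. *)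

theory Defs
  imports Complex_Main "HOL-Library.FuncSet" "HOL-Library.Sublist"
begin

definition palindrome :: "'a list \<Rightarrow> bool" where
  "palindrome w \<longleftrightarrow> rev w = w"

definition rich :: "'a list \<Rightarrow> bool" where
  "rich w \<longleftrightarrow> card {u. sublist u w \<and> u \<noteq> [] \<and> palindrome u} = length w"

definition num_rich :: "'a set \<Rightarrow> nat \<Rightarrow> nat" where
  "num_rich A n = card {w. set w \<subseteq> A \<and> length w = n \<and> rich w}"

text \<open>Functions on the reals at least 1 are total functions on the reals; their values at
  arguments below 1 are unconstrained.\<close>

definition Delta :: "(real \<Rightarrow> real) set" where
  "Delta = {\<phi>. \<phi> \<in> {1..} \<rightarrow> {1..} \<and> filterlim \<phi> at_top at_top}"

definition Phi :: "(real \<Rightarrow> real) set" where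
  "Phi = {\<phi> \<in> Delta. filterlim (\<lambda>x. x / \<phi> x) at_top at_top}"

function ln_star :: "real \<Rightarrow> nat" where
  "ln_star x = (if x \<le> 1 then 0 else 1 + ln_star (ln x))"
  by auto
termination
proof (relation "measure (\<lambda>x. nat \<lceil>x\<rceil>)")
  fix x :: real
  assume "\<not> x \<le> 1"
  then have "ln x \<le> x - 1" and "1 < x"
    by (simp_all add: ln_le_minus_one)
  then have "\<lceil>ln x\<rceil> \<le> \<lceil>x\<rceil> - 1" and "1 < \<lceil>x\<rceil>"
    by linarith+
  then show "(ln x, x) \<in> measure (\<lambda>x. nat \<lceil>x\<rceil>)"
    by simp
qed simp

declare ln_star.simps [simp del]

end

theory Submission
  imports Defs
begin

text \<open>Splitting off longest palindromic suffixes writes a rich word of length \<open>n\<close> as a product of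
  distinct rich palindromes. There are at most \<open>q ^ L + n / L\<close> of them for every \<open>L\<close>, and each is
  determined by its first half, a rich word. So a bound \<open>R(m) \<le> exp (K + s m)\<close> for all \<open>m\<close>
  improves itself: up to an arbitrarily small loss, \<open>s\<close> is halved (we settle for the factor
  \<open>7/8\<close>), while \<open>K\<close> grows at most to \<open>exp (exp K)\<close>. The \<open>k\<close>-th bound is therefore effective once
  \<open>n\<close> exceeds an exponential tower of height about \<open>2 k\<close>, that is, for \<open>k\<close> proportional to
  \<open>ln\<^sup>* n\<close>; this gives \<open>R(n) \<le> q powr (n / 2 powr (f(n) - 1))\<close> for small \<open>c\<close>, even without the
  term \<open>n / \<phi>(n)\<close> in the exponent.\<close>

section \<open>Palindromic factors of rich words and their factorization into palindromes\<close>

definition pal_factors :: "'a list \<Rightarrow> 'a list set" where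
  "pal_factors w = {u. sublist u w \<and> u \<noteq> [] \<and> palindrome u}"

lemma rich_iff: "rich w \<longleftrightarrow> card (pal_factors w) = length w"
  by (simp add: rich_def pal_factors_def)

lemma finite_pal_factors [simp]: "finite (pal_factors w)"
proof (rule finite_subset)
  show "pal_factors w \<subseteq> set (sublists w)"
    by (auto simp: pal_factors_def)
qed simp

definition longest_pal_suffix :: "'a list \<Rightarrow> 'a list \<Rightarrow> bool" where
  "longest_pal_suffix v w \<longleftrightarrow> suffix v w \<and> v \<noteq> [] \<and> palindrome v \<and>
     (\<forall>u. suffix u w \<and> palindrome u \<longrightarrow> length u \<le> length v)"

lemma longest_pal_suffix_exists:
  assumes "w \<noteq> []"
  shows "\<exists>v. longest_pal_suffix v w"
proof -
  let ?P = "\<lambda>v. suffix v w \<and> v \<noteq> [] \<and> palindrome v"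
  have "?P [last w]"
    using append_butlast_last_id[OF assms] by (simp add: palindrome_def) (metis suffixI)
  moreover have "\<forall>v. ?P v \<longrightarrow> length v < Suc (length w)"
    by (auto simp: less_Suc_eq_le dest: suffix_length_le)
  ultimately obtain v where "?P v" "\<forall>u. ?P u \<longrightarrow> length u \<le> length v"
    using ex_has_greatest_nat[of ?P "[last w]" length "Suc (length w)"] by blast
  then have "longest_pal_suffix v w"
    unfolding longest_pal_suffix_def by (metis le0 list.size(3))
  then show ?thesis ..
qed

text \<open>A palindromic suffix shorter than the longest one \<open>v\<close> is, by reflection inside \<open>v\<close>,
  also a prefix of \<open>v\<close>, so it already occurs without the last letter.\<close>
lemma pal_factors_snoc:
  assumes v: "longest_pal_suffix v (w @ [a])"
  shows "pal_factors (w @ [a]) \<subseteq> insert v (pal_factors w)"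
proof
  fix u assume "u \<in> pal_factors (w @ [a])"
  then have u: "sublist u (w @ [a])" "u \<noteq> []" "palindrome u"
    by (auto simp: pal_factors_def)
  show "u \<in> insert v (pal_factors w)"
  proof (cases "suffix u (w @ [a])")
    case False
    then show ?thesis
      using u sublist_snoc[of u w a] by (auto simp: pal_factors_def)
  next
    case True
    then have len: "length u \<le> length v" and sv: "suffix v (w @ [a])" and pv: "palindrome v"
      using v u by (auto simp: longest_pal_suffix_def)
    have "suffix u v"
      using True sv len by (rule suffix_length_suffix)
    then obtain t where t: "v = t @ u"
      by (auto simp: suffix_def)
    then have v': "v = u @ rev t"
      using u(3) pv by (metis palindrome_def rev_append)
    show ?thesis
    proof (cases "t = []")
      case True
      then show ?thesis using t by simp
    next
      case False
      obtain s where "w @ [a] = s @ u @ rev t"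
        using sv v' by (auto simp: suffix_def)
      then have "w = s @ u @ butlast (rev t)"
        using False by (metis butlast_append butlast_snoc append_is_Nil_conv rev_is_Nil_conv)
      then have "sublist u w"
        by (auto simp: sublist_def)
      then show ?thesis
        using u by (simp add: pal_factors_def)
    qed
  qed
qed

text \<open>By \<open>pal_factors_snoc\<close>, each appended letter contributes at most one new
  palindrome. Rich words are thus exactly the words attaining this bound.\<close>

lemma card_pal_factors_le: "card (pal_factors w) \<le> length w"
proof (induction w rule: rev_induct)
  case Nil
  then show ?case by (simp add: pal_factors_def)
next
  case (snoc a w)
  obtain v where "longest_pal_suffix v (w @ [a])"
    using longest_pal_suffix_exists by blast
  then have "card (pal_factors (w @ [a])) \<le> card (insert v (pal_factors w))"
    by (intro card_mono pal_factors_snoc) auto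
  also have "\<dots> \<le> Suc (card (pal_factors w))"
    by (simp add: card_insert_if)
  finally show ?case using snoc by simp
qed

text \<open>Equality in \<open>card_pal_factors_le\<close> forces every letter to contribute a new
  palindrome, and the only candidate for the last letter is the longest palindromic suffix.\<close>

lemma rich_snocD:
  assumes r: "rich (w @ [a])" and v: "longest_pal_suffix v (w @ [a])"
  shows "rich w" "\<not> sublist v w"
proof -
  have le: "card (pal_factors (w @ [a])) \<le> card (insert v (pal_factors w))"
    using pal_factors_snoc[OF v] by (intro card_mono) auto
  then show "rich w"
    using r card_pal_factors_le[of w] card_insert_if[of "pal_factors w" v]
    by (auto simp: rich_iff split: if_splits)
  show "\<not> sublist v w"
  proof
    assume "sublist v w"
    then have "insert v (pal_factors w) = pal_factors w"
      using v by (auto simp: pal_factors_def longest_pal_suffix_def)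
    then show False
      using le r card_pal_factors_le[of w] by (simp add: rich_iff)
  qed
qed

lemma rich_appendD1: "rich (u @ v) \<Longrightarrow> rich u"
proof (induction v rule: rev_induct)
  case (snoc a v)
  then show ?case
    using rich_snocD(1)[of "u @ v" a] longest_pal_suffix_exists[of "u @ v @ [a]"] by auto
qed simp

lemma rich_rev: "rich w \<Longrightarrow> rich (rev w)"
proof -
  have "pal_factors (rev w) = pal_factors w"
    by (auto simp: pal_factors_def palindrome_def) (metis sublist_rev)+
  then show "rich w \<Longrightarrow> rich (rev w)"
    by (simp add: rich_iff)
qed

lemma rich_appendD2: "rich (u @ v) \<Longrightarrow> rich v"
  by (metis rich_appendD1 rich_rev rev_append rev_rev_ident)

text \<open>Split off the longest palindromic suffix \<open>v\<close> and recurse on the remaining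
  prefix. Distinctness holds because \<open>v\<close> has no occurrence in the word without its last
  letter, where all the other factors lie.\<close>

lemma rich_palindromic_factorization:
  "rich w \<Longrightarrow> \<exists>vs. concat vs = w \<and> distinct vs \<and>
     (\<forall>v \<in> set vs. v \<noteq> [] \<and> palindrome v \<and> rich v)"
proof (induction w rule: length_induct)
  case (1 w)
  show ?case
  proof (cases "w = []")
    case True
    then show ?thesis by (intro exI[of _ "[]"]) simp
  next
    case False
    then obtain w' a where w': "w = w' @ [a]"
      by (metis rev_exhaust)
    obtain v where v: "longest_pal_suffix v w"
      using longest_pal_suffix_exists False by blast
    have nv: "\<not> sublist v w'"
      using rich_snocD(2)[of w' a v] v 1(2) w' by simp
    obtain x where x: "w = x @ v"
      using v by (auto simp: longest_pal_suffix_def suffix_def)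
    have ne: "v \<noteq> []" and pv: "palindrome v"
      using v by (auto simp: longest_pal_suffix_def)
    have "rich x" "rich v"
      using 1(2) x rich_appendD1 rich_appendD2 by blast+
    then obtain vs where vs: "concat vs = x" "distinct vs"
      "\<forall>v \<in> set vs. v \<noteq> [] \<and> palindrome v \<and> rich v"
      using 1(1)[rule_format, of x] x ne by auto
    have "w' = x @ butlast v"
      using x w' ne by (metis butlast_append butlast_snoc)
    have "v \<notin> set vs"
    proof
      assume "v \<in> set vs"
      then obtain ys zs where "vs = ys @ v # zs"
        by (meson split_list)
      \<comment> \<open>As \<open>v\<close> is nonempty, the prefix \<open>x\<close> lies inside
        \<open>w'\<close>, so a repeated factor would be an occurrence of \<open>v\<close> in
        \<open>w'\<close>.\<close>
      then have "w' = concat ys @ v @ (concat zs @ butlast v)"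
        using vs(1) \<open>w' = x @ butlast v\<close> by auto
      then show False
        using nv by (metis sublist_appendI)
    qed
    then show ?thesis
      using vs x ne pv \<open>rich v\<close> by (intro exI[of _ "vs @ [v]"]) auto
  qed
qed

section \<open>Counting rich words through their factorizations\<close>

lemma sum_power_le_power:
  fixes q :: nat
  assumes "q \<ge> 2"
  shows "(\<Sum>i<L. q ^ i) \<le> q ^ L"
proof (induction L)
  case (Suc L)
  then have "(\<Sum>i<Suc L. q ^ i) \<le> 2 * q ^ L" by simp
  also have "\<dots> \<le> q ^ Suc L" using assms by simp
  finally show ?case .
qed simp

text \<open>Distinctness limits the words shorter than \<open>L\<close> to the number of all such
  words, at most \<open>card A ^ L\<close>; each other word uses up at least \<open>L\<close>
  letters of the concatenation.\<close>

lemma length_distinct_words_le: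
  assumes A: "finite A" "card A \<ge> 2" and "L \<ge> 1"
    and vs: "distinct vs" "set (concat vs) \<subseteq> A"
  shows "length vs \<le> card A ^ L + length (concat vs) div L"
proof -
  let ?short = "filter (\<lambda>v. length v < L) vs" and ?long = "filter (\<lambda>v. \<not> length v < L) vs"
  have "length ?short = card (set ?short)"
    by (rule distinct_card[symmetric]) (use vs in simp)
  also have "\<dots> \<le> card {v. set v \<subseteq> A \<and> length v \<le> L - 1}"
    using assms by (intro card_mono finite_lists_length_le) auto
  also have "\<dots> = (\<Sum>i<L. card A ^ i)"
    using assms by (subst card_lists_length_le) (auto intro!: sum.cong)
  also have "\<dots> \<le> card A ^ L"
    by (rule sum_power_le_power) (use A in simp)
  finally have short: "length ?short \<le> card A ^ L" .
  have "L * length ?long \<le> length (concat vs)"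
    by (induction vs) auto
  then have "length ?long \<le> length (concat vs) div L"
    using \<open>L \<ge> 1\<close> by (simp add: less_eq_div_iff_mult_less_eq mult.commute)
  then show ?thesis
    using short sum_length_filter_compl[of "\<lambda>v. length v < L" vs] by simp
qed

text \<open>Expansion of a power of a sum. With \<open>g v = x ^ length v\<close> it turns a count
  of lists of palindromes by total length into a power of one generating function.\<close>

lemma sum_prod_list_lists:
  fixes g :: "'b \<Rightarrow> real"
  assumes "finite F"
  shows "(\<Sum>vs | set vs \<subseteq> F \<and> length vs = P. prod_list (map g vs)) = (\<Sum>v\<in>F. g v) ^ P"
proof (induction P)
  case 0
  have "{vs. set vs \<subseteq> F \<and> length vs = 0} = {[]}" by auto
  then show ?case by simp
next
  case (Suc P)
  let ?S = "{vs. set vs \<subseteq> F \<and> length vs = P}"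
  have "{vs. set vs \<subseteq> F \<and> length vs = Suc P} = (\<lambda>(v, vs). v # vs) ` (F \<times> ?S)"
    by (auto simp: length_Suc_conv image_iff)
  then have "(\<Sum>vs | set vs \<subseteq> F \<and> length vs = Suc P. prod_list (map g vs))
      = (\<Sum>(v, vs) \<in> F \<times> ?S. g v * prod_list (map g vs))"
    by (simp add: sum.reindex inj_on_def case_prod_beta)
  also have "\<dots> = (\<Sum>v\<in>F. g v) * (\<Sum>vs\<in>?S. prod_list (map g vs))"
    by (simp add: sum_product sum.cartesian_product)
  finally show ?case using Suc by simp
qed

text \<open>The first half of a palindrome, including a middle letter, determines it, and this half
  is rich as a prefix of a rich word.\<close>

lemma card_rich_palindromes_le:
  assumes "finite A"
  shows "card {v. set v \<subseteq> A \<and> length v = m \<and> palindrome v \<and> rich v}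
    \<le> num_rich A ((m + 1) div 2)"
proof -
  let ?X = "{v. set v \<subseteq> A \<and> length v = m \<and> palindrome v \<and> rich v}" and ?h = "(m + 1) div 2"
  have "inj_on (take ?h) ?X"
  proof (rule inj_onI)
    fix u v assume u: "u \<in> ?X" and v: "v \<in> ?X" and eq: "take ?h u = take ?h v"
    \<comment> \<open>A position past the first half is read off at its mirror image
      \<open>m - 1 - i\<close>, which lies inside the first half.\<close>
    have "x ! i = take ?h x ! (if i < ?h then i else m - 1 - i)" if "x \<in> ?X" "i < m" for x i
    proof (cases "i < ?h")
      case False
      have "x ! i = rev x ! i" using that by (simp add: palindrome_def)
      then show ?thesis using that False by (simp add: rev_nth)
    qed simp
    then show "u = v"
      using u v eq by (intro nth_equalityI) auto
  qed
  moreover have "take ?h ` ?X \<subseteq> {w. set w \<subseteq> A \<and> length w = ?h \<and> rich w}"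
  proof (rule image_subsetI)
    fix x assume "x \<in> ?X"
    then show "take ?h x \<in> {w. set w \<subseteq> A \<and> length w = ?h \<and> rich w}"
      using rich_appendD1[of "take ?h x" "drop ?h x"] by (auto dest: in_set_takeD)
  qed
  moreover have "finite {w. set w \<subseteq> A \<and> length w = ?h \<and> rich w}"
    by (rule finite_subset[OF _ finite_lists_length_eq[OF assms, of ?h]]) auto
  ultimately show ?thesis
    unfolding num_rich_def by (rule card_inj_on_le)
qed


lemma num_rich_le_power:
  assumes "finite A"
  shows "num_rich A n \<le> card A ^ n"
proof -
  have "num_rich A n \<le> card {w. set w \<subseteq> A \<and> length w = n}"
    unfolding num_rich_def using assms by (intro card_mono finite_lists_length_eq) auto
  then show ?thesis using assms by (simp add: card_lists_length_eq)
qed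

text \<open>Factorizations are padded with empty words to a common number of factors.\<close>
lemma num_rich_le_power_sum:
  fixes x :: real
  assumes A: "finite A" "card A \<ge> 2" and "L \<ge> 1" and x: "x > 0"
  shows "real (num_rich A n) * x ^ n
    \<le> (\<Sum>m\<le>n. real (num_rich A ((m + 1) div 2)) * x ^ m) ^ (card A ^ L + n div L)"
proof -
  let ?P = "card A ^ L + n div L"
  let ?F = "{v. set v \<subseteq> A \<and> length v \<le> n \<and> palindrome v \<and> rich v}"
  let ?X = "\<lambda>m. {v. set v \<subseteq> A \<and> length v = m \<and> palindrome v \<and> rich v}"
  let ?W = "{w. set w \<subseteq> A \<and> length w = n \<and> rich w}"
  let ?S = "{vs. set vs \<subseteq> ?F \<and> length vs = ?P}"
  let ?T = "{vs \<in> ?S. length (concat vs) = n}"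
  have finF: "finite ?F"
    by (rule finite_subset[OF _ finite_lists_length_le[OF A(1), of n]]) auto
  have finS: "finite ?S"
    using finF by (rule finite_lists_length_eq)
  have finX: "finite (?X m)" for m
    by (rule finite_subset[OF _ finite_lists_length_eq[OF A(1), of m]]) auto
  have weight: "prod_list (map (\<lambda>v. x ^ length v) vs) = x ^ length (concat vs)" for vs :: "'a list list"
    by (induction vs) (auto simp: power_add)
  have "(\<Sum>v\<in>?F. x ^ length v) = (\<Sum>m\<le>n. \<Sum>v\<in>?X m. x ^ length v)"
  proof -
    have "?F = (\<Union>m\<le>n. ?X m)" by auto
    then show ?thesis
      using finX by (simp only:) (rule sum.UNION_disjoint, auto)
  qed
  also have "\<dots> \<le> (\<Sum>m\<le>n. real (num_rich A ((m + 1) div 2)) * x ^ m)"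
  proof (rule sum_mono)
    fix m
    have "(\<Sum>v\<in>?X m. x ^ length v) = real (card (?X m)) * x ^ m"
      by simp
    also have "\<dots> \<le> real (num_rich A ((m + 1) div 2)) * x ^ m"
      using x card_rich_palindromes_le[OF A(1), of m] by (intro mult_right_mono) auto
    finally show "(\<Sum>v\<in>?X m. x ^ length v) \<le> real (num_rich A ((m + 1) div 2)) * x ^ m" .
  qed
  finally have sum_le: "(\<Sum>v\<in>?F. x ^ length v)
    \<le> (\<Sum>m\<le>n. real (num_rich A ((m + 1) div 2)) * x ^ m)" .
  have "?W \<subseteq> concat ` ?T"
  proof
    fix w assume w: "w \<in> ?W"
    then obtain vs where vs: "concat vs = w" "distinct vs"
        "\<forall>v \<in> set vs. v \<noteq> [] \<and> palindrome v \<and> rich v"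
      using rich_palindromic_factorization[of w] by auto
    have len: "length vs \<le> ?P"
      using length_distinct_words_le[OF A \<open>L \<ge> 1\<close> vs(2)] vs(1) w by simp
    have "length v \<le> n" if "v \<in> set vs" for v
      using that vs(1) w by (auto dest!: split_list)
    moreover have "set v \<subseteq> A" if "v \<in> set vs" for v
      using that vs(1) w by (metis (mono_tags, lifting) UN_upper mem_Collect_eq order.trans set_concat)
    moreover have "length (concat vs) = n"
      using vs(1) w by simp
    moreover have "rich []" "palindrome []"
      by (auto simp: rich_def palindrome_def)
    ultimately have "vs @ replicate (?P - length vs) [] \<in> ?T"
      using vs(3) len by auto
    moreover have "w = concat (vs @ replicate (?P - length vs) [])"
      using vs(1) by simp
    ultimately show "w \<in> concat ` ?T" by blast
  qed
  then have "num_rich A n \<le> card ?T"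
    unfolding num_rich_def using finS by (intro surj_card_le finite_subset[of ?T ?S]) auto
  then have "real (num_rich A n) * x ^ n \<le> real (card ?T) * x ^ n"
    using x by (intro mult_right_mono) auto
  also have "\<dots> = (\<Sum>vs\<in>?T. prod_list (map (\<lambda>v. x ^ length v) vs))"
    by (simp add: weight)
  \<comment> \<open>Dropping the condition on the total length lets the sum factor as a
    power.\<close>
  also have "\<dots> \<le> (\<Sum>vs\<in>?S. prod_list (map (\<lambda>v. x ^ length v) vs))"
    using finS x by (intro sum_mono2) (auto simp: weight)
  also have "\<dots> = (\<Sum>v\<in>?F. x ^ length v) ^ ?P"
    by (rule sum_prod_list_lists[OF finF])
  also have "\<dots> \<le> (\<Sum>m\<le>n. real (num_rich A ((m + 1) div 2)) * x ^ m) ^ ?P"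
    using sum_le x by (intro power_mono sum_nonneg) auto
  finally show ?thesis .
qed

text \<open>With the weight \<open>x = exp (- 3 / 4 * s)\<close> the halving of palindromes makes the sum over all
  factors a convergent geometric series.\<close>
lemma num_rich_step:
  assumes A: "finite A" "card A \<ge> 2" and "L \<ge> 1" and s: "s > 0" and K: "K \<ge> 0"
    and bound: "\<And>m. real (num_rich A m) \<le> exp (K + s * real m)"
  shows "real (num_rich A n)
    \<le> exp ((K + s / 2 + 4 / s) * (real (card A) ^ L + real n / real L) + 3 / 4 * s * real n)"
proof -
  let ?E = "K + s / 2 + 4 / s" and ?P = "card A ^ L + n div L"
  let ?x = "exp (- (3 / 4 * s))" and ?y = "exp (- (s / 4))"
  have y: "0 < ?y" "?y < 1" using s by auto
  have "(\<Sum>m\<le>n. real (num_rich A ((m + 1) div 2)) * ?x ^ m) \<le> (\<Sum>m\<le>n. exp (K + s / 2) * ?y ^ m)"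
  proof (rule sum_mono)
    fix m :: nat
    have "s * real ((m + 1) div 2) \<le> s * (real (m + 1) / 2)"
      using s of_nat_div_le_of_nat[of "m + 1" 2, where ?'a = real] by (intro mult_left_mono) simp_all
    then have "real (num_rich A ((m + 1) div 2)) \<le> exp (K + s * (real (m + 1) / 2))"
      by (intro order.trans[OF bound]) simp
    then have "real (num_rich A ((m + 1) div 2)) * ?x ^ m
        \<le> exp (K + s * (real (m + 1) / 2)) * ?x ^ m"
      by (intro mult_right_mono) auto
    \<comment> \<open>Halving leaves the rate \<open>s / 2\<close>, which the weight
      \<open>3 / 4 * s\<close> outweighs:
      \<open>s * (m + 1) / 2 - 3 / 4 * s * m = s / 2 - s / 4 * m\<close>.\<close>
    also have "\<dots> = exp (K + s / 2) * ?y ^ m"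
      by (simp add: exp_of_nat_mult[symmetric] exp_add[symmetric] field_simps)
    finally show "real (num_rich A ((m + 1) div 2)) * ?x ^ m \<le> exp (K + s / 2) * ?y ^ m" .
  qed
  also have "\<dots> = exp (K + s / 2) * (\<Sum>m\<le>n. ?y ^ m)"
    by (simp add: sum_distrib_left)
  also have "\<dots> \<le> exp (K + s / 2) * exp (4 / s)"
  proof (rule mult_left_mono)
    have "(\<Sum>m\<le>n. ?y ^ m) = (1 - ?y ^ Suc n) / (1 - ?y)"
      using y by (subst sum_gp0) auto
    also have "\<dots> \<le> 1 / (1 - ?y)"
      using y by (intro divide_right_mono) auto
    also have "\<dots> \<le> 1 + 4 / s"
    proof -
      have "1 + s / 4 \<le> exp (s / 4)" by (rule exp_ge_add_one_self)
      then have "?y \<le> 1 / (1 + s / 4)"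
        using s by (simp add: exp_minus field_simps)
      then have "1 - ?y \<ge> s / (4 + s)"
        using s by (simp add: field_simps)
      then have "1 / (1 - ?y) \<le> 1 / (s / (4 + s))"
        using s by (intro divide_left_mono) auto
      then show ?thesis using s by (simp add: field_simps)
    qed
    also have "\<dots> \<le> exp (4 / s)" by (rule exp_ge_add_one_self)
    finally show "(\<Sum>m\<le>n. ?y ^ m) \<le> exp (4 / s)" .
  qed simp
  also have "\<dots> = exp ?E" by (simp add: exp_add)
  finally have "(\<Sum>m\<le>n. real (num_rich A ((m + 1) div 2)) * ?x ^ m) ^ ?P \<le> exp ?E ^ ?P"
    by (intro power_mono) (auto intro: sum_nonneg)
  then have "real (num_rich A n) * ?x ^ n \<le> exp ?E ^ ?P"
    using num_rich_le_power_sum[OF A \<open>L \<ge> 1\<close>, of ?x n] by simp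
  also have "\<dots> = exp (?E * real ?P)"
    by (rule exp_of_nat2_mult[symmetric])
  also have "\<dots> \<le> exp (?E * (real (card A) ^ L + real n / real L))"
  proof -
    have "real ?P \<le> real (card A) ^ L + real n / real L"
      using of_nat_div_le_of_nat[of n L, where ?'a = real] by simp
    then show ?thesis using K s by (simp del: of_nat_add add: mult_left_mono)
  qed
  \<comment> \<open>Cancelling the weight \<open>?x ^ n\<close> brings back the rate
    \<open>3 / 4 * s\<close>.\<close>
  finally have "real (num_rich A n) * ?x ^ n * exp (3 / 4 * s * real n)
      \<le> exp (?E * (real (card A) ^ L + real n / real L)) * exp (3 / 4 * s * real n)"
    by (intro mult_right_mono) auto
  moreover have "?x ^ n * exp (3 / 4 * s * real n) = 1"
    by (simp add: exp_of_nat_mult[symmetric] exp_add[symmetric] field_simps)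
  ultimately show ?thesis
    by (simp only: exp_add mult.assoc mult_1_right)
qed

section \<open>Iterating the improvement along exponential towers\<close>

text \<open>A tower of \<open>2 * k\<close> exponentials over \<open>M\<close>: one level is the
  growth of the additive constant in one improvement step.\<close>

definition exp_tower :: "real \<Rightarrow> nat \<Rightarrow> real" where
  "exp_tower M k = ((\<lambda>y. exp (exp y)) ^^ k) M"

lemma exp_tower_0 [simp]: "exp_tower M 0 = M"
  and exp_tower_Suc [simp]: "exp_tower M (Suc k) = exp (exp (exp_tower M k))"
  by (simp_all add: exp_tower_def)

lemma exp_tower_Suc_ge: "exp_tower M k + 1 \<le> exp_tower M (Suc k)"
proof -
  have "exp_tower M k + 1 \<le> exp (exp_tower M k)"
    using exp_ge_add_one_self[of "exp_tower M k"] by linarith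
  also have "\<dots> \<le> exp (exp (exp_tower M k))"
    using exp_ge_add_one_self[of "exp (exp_tower M k)"] by linarith
  finally show ?thesis by simp
qed

lemma exp_tower_mono: "j \<le> k \<Longrightarrow> exp_tower M j \<le> exp_tower M k"
proof (induction k rule: dec_induct)
  case (step k)
  then show ?case using exp_tower_Suc_ge[of M k] by linarith
qed simp

lemma exp_tower_ge: "M + real k \<le> exp_tower M k"
proof (induction k)
  case (Suc k)
  then show ?case using exp_tower_Suc_ge[of M k] by simp
qed simp

text \<open>From \<open>(1 + y / 4) ^ 4 \<le> exp y\<close>. The threshold is
  \<open>14080 = 55 * 256\<close>, so that one factor \<open>y / 256\<close> pays for the constant
  55.\<close>

lemma cube_le_exp:
  fixes y :: real
  assumes "y \<ge> 14080"
  shows "55 * y ^ 3 \<le> exp y"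
proof -
  have "55 * y ^ 3 \<le> (y / 256) * y ^ 3"
    using assms by (intro mult_right_mono) auto
  also have "\<dots> = (y / 4) ^ 4"
    by (simp add: power_divide power3_eq_cube power4_eq_xxxx)
  also have "\<dots> \<le> (1 + y / real 4) ^ 4"
    using assms by (intro power_mono) auto
  also have "\<dots> \<le> exp y"
    using assms by (intro exp_ge_one_plus_x_over_n_power_n) auto
  finally show ?thesis .
qed

text \<open>Its use is that the square of one tower level stays below the next level.\<close>

lemma square_le_exp_exp:
  fixes y :: real
  assumes "y \<ge> 14080"
  shows "y ^ 2 \<le> exp (exp y)"
proof -
  have "y ^ 2 * 1 \<le> y ^ 2 * (55 * y)"
    using assms by (intro mult_left_mono) auto
  also have "\<dots> = 55 * y ^ 3"
    by (simp add: power2_eq_square power3_eq_cube)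
  also have "\<dots> \<le> exp y"
    by (rule cube_le_exp[OF assms])
  also have "\<dots> \<le> exp (exp y)"
    using exp_ge_add_one_self[of "exp y"] by linarith
  finally show ?thesis by simp
qed

text \<open>Each step multiplies the exponential rate by \<open>7/8\<close>; taking pieces longer than
  \<open>L = 8 E / s\<close> costs a constant factor \<open>exp (E * q ^ L)\<close>, which is doubly exponential in the
  previous one.\<close>
lemma num_rich_le_exp_tower:
  assumes A: "finite A" "card A \<ge> 2"
    and M: "M \<ge> 14080" "M \<ge> ln (card A)" "M \<ge> 1 / ln (card A)"
  shows "1 / (ln (card A) * (7/8) ^ k) \<le> exp_tower M k"
    and "real (num_rich A n) \<le> exp (exp_tower M k + ln (card A) * (7/8) ^ k * real n)"
proof -
  have s0: "ln (card A) > 0" using A by simp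
  \<comment> \<open>Both claims go through one induction: the bound on \<open>1 / s\<close> keeps
    \<open>E\<close> linear and \<open>L\<close> quadratic in \<open>K\<close>.\<close>
  have "1 / (ln (card A) * (7/8) ^ k) \<le> exp_tower M k \<and>
    (\<forall>n. real (num_rich A n) \<le> exp (exp_tower M k + ln (card A) * (7/8) ^ k * real n))"
  proof (induction k)
    case 0
    have "real (num_rich A n) \<le> exp (M + ln (card A) * real n)" for n
    proof -
      have "real (num_rich A n) \<le> real (card A) ^ n"
        using num_rich_le_power[OF A(1), of n] by (metis of_nat_le_iff of_nat_power)
      also have "\<dots> = exp (ln (card A) * real n)"
        using A by (simp add: exp_of_nat2_mult)
      also have "\<dots> \<le> exp (M + ln (card A) * real n)"
        using M by simp
      finally show ?thesis .
    qed
    then show ?case using M by simp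
  next
    case (Suc k)
    define K where "K = exp_tower M k"
    define s where "s = ln (card A) * (7/8) ^ k"
    define E where "E = K + s / 2 + 4 / s"
    define L where "L = nat \<lceil>8 * E / s\<rceil>"
    have MK: "M \<le> K"
      unfolding K_def using exp_tower_mono[of 0 k M] by simp
    have K: "K \<ge> 14080" using MK M by simp
    have s: "s > 0" using s0 by (simp add: s_def)
    have invs: "1 / s \<le> K" using Suc by (simp add: s_def K_def)
    have "s \<le> ln (card A)"
      unfolding s_def using s0 by (simp add: mult_le_cancel_left1 power_le_one)
    then have "s \<le> K" using M MK by simp
    \<comment> \<open>The three summands of \<open>E\<close> are at most \<open>K\<close>,
      \<open>K / 2\<close> and \<open>4 * K\<close>.\<close>
    then have E6: "E \<le> 6 * K"
      using invs s K by (simp add: E_def)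
    have E0: "E > 0" using s K by (simp add: E_def add_pos_pos)
    have L1: "L \<ge> 1" using E0 s by (simp add: L_def Suc_le_eq)
    have L8: "8 * E / s \<le> real L" unfolding L_def by (rule real_nat_ceiling_ge)
    have "8 * E / s = 8 * E * (1 / s)" by simp
    also have "\<dots> \<le> (8 * (6 * K)) * K"
      using E6 E0 invs K s by (intro mult_mono) auto
    finally have "8 * E / s \<le> 48 * K ^ 2" by (simp add: power2_eq_square)
    moreover have "real L \<le> 8 * E / s + 1"
    proof -
      have "0 \<le> 8 * E / s" using E0 s by simp
      then show ?thesis unfolding L_def by linarith
    qed
    moreover have "1 \<le> K ^ 2" using K by (simp add: one_le_power)
    ultimately have "real L \<le> 49 * K ^ 2" by simp
    then have "ln (card A) * real L \<le> K * (49 * K ^ 2)"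
      using s0 M MK K by (intro mult_mono) auto
    then have "ln (card A) * real L \<le> 49 * K ^ 3"
      by (simp add: power2_eq_square power3_eq_cube)
    then have qL: "real (card A) ^ L \<le> exp (49 * K ^ 3)"
    proof -
      have "real (card A) ^ L = exp (ln (card A) * real L)"
        using A by (simp add: exp_of_nat2_mult)
      then show ?thesis using \<open>ln (card A) * real L \<le> 49 * K ^ 3\<close> by simp
    qed
    have "6 * K \<le> 6 * K ^ 3"
      using K by (simp add: self_le_power)
    then have "6 * K \<le> exp (6 * K ^ 3)"
      using exp_ge_add_one_self[of "6 * K ^ 3"] by linarith
    \<comment> \<open>The exponents \<open>6 * K ^ 3\<close> and \<open>49 * K ^ 3\<close> add up to
      the 55 of \<open>cube_le_exp\<close>.\<close>
    then have "E * real (card A) ^ L \<le> exp (6 * K ^ 3) * exp (49 * K ^ 3)"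
      using E6 E0 qL by (intro mult_mono) auto
    also have "\<dots> = exp (55 * K ^ 3)"
      by (simp add: exp_add[symmetric])
    also have "\<dots> \<le> exp (exp K)"
      using cube_le_exp[OF K] by simp
    finally have EqL: "E * real (card A) ^ L \<le> exp (exp K)" .
    have "real (num_rich A n) \<le> exp (exp (exp K) + 7 / 8 * s * real n)" for n
    proof -
      \<comment> \<open>The long factors add \<open>s / 8\<close> to the rate
        \<open>3 / 4 * s\<close>, which makes \<open>7 / 8 * s\<close>.\<close>
      have "E / real L \<le> s / 8"
        using L8 L1 s by (simp add: field_simps)
      then have "E / real L * real n \<le> s / 8 * real n"
        by (rule mult_right_mono) simp
      moreover have "E * (real (card A) ^ L + real n / real L) = E * real (card A) ^ L + E / real L * real n"
        by (simp add: distrib_left)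
      ultimately have "E * (real (card A) ^ L + real n / real L) + 3 / 4 * s * real n
          \<le> exp (exp K) + 7 / 8 * s * real n"
        using EqL by linarith
      moreover have "real (num_rich A n)
          \<le> exp (E * (real (card A) ^ L + real n / real L) + 3 / 4 * s * real n)"
        unfolding E_def
        by (rule num_rich_step[OF A L1 s]) (use K Suc in \<open>auto simp: s_def K_def\<close>)
      ultimately show ?thesis
        by (meson exp_le_cancel_iff order.trans)
    qed
    moreover have "1 / (ln (card A) * (7/8) ^ Suc k) \<le> exp (exp K)"
    proof -
      have "1 / (ln (card A) * (7/8) ^ Suc k) = 8 / 7 * (1 / s)"
        by (simp add: s_def)
      also have "\<dots> \<le> K * K"
        using invs K s by (intro mult_mono) auto
      also have "\<dots> \<le> exp (exp K)"
        using square_le_exp_exp[OF K] by (simp add: power2_eq_square)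
      finally show ?thesis .
    qed
    ultimately show ?case
      by (simp add: K_def s_def mult.assoc mult.left_commute)
  qed
  then show "1 / (ln (card A) * (7/8) ^ k) \<le> exp_tower M k"
    and "real (num_rich A n) \<le> exp (exp_tower M k + ln (card A) * (7/8) ^ k * real n)"
    by auto
qed

section \<open>The iterated logarithm and the bound expressed through it\<close>

lemma ln_star_mono: "x \<le> y \<Longrightarrow> ln_star x \<le> ln_star y"
proof (induction x arbitrary: y rule: ln_star.induct)
  case (1 x)
  show ?case
  proof (cases "x \<le> 1")
    case True
    then show ?thesis by (simp add: ln_star.simps[of x])
  next
    case False
    then have "ln_star (ln x) \<le> ln_star (ln y)"
      using 1 by simp
    then show ?thesis
      using False 1(2) by (simp add: ln_star.simps[of x] ln_star.simps[of y])
  qed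
qed

lemma ln_star_exp: "x > 0 \<Longrightarrow> ln_star (exp x) = Suc (ln_star x)"
  by (simp add: ln_star.simps[of "exp x"])

lemma ln_star_exp_tower:
  assumes "M > 0"
  shows "ln_star (exp_tower M k) = 2 * k + ln_star M"
proof (induction k)
  case (Suc k)
  have "exp_tower M k > 0"
    using exp_tower_mono[of 0 k M] assms by simp
  then show ?case using Suc by (simp add: ln_star_exp)
qed simp

text \<open>By monotonicity, unboundedness along the towers over 1 suffices.\<close>

lemma filterlim_ln_star: "filterlim (\<lambda>x. real (ln_star x)) at_top at_top"
  unfolding filterlim_at_top
proof
  fix Z :: real
  let ?k = "nat \<lceil>Z\<rceil>"
  have "Z \<le> real (ln_star x)" if "x \<ge> exp_tower 1 ?k" for x
  proof -
    have "ln_star (exp_tower 1 ?k) \<le> ln_star x"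
      by (rule ln_star_mono[OF that])
    then show ?thesis
      using ln_star_exp_tower[of 1 ?k] by linarith
  qed
  then show "eventually (\<lambda>x. Z \<le> real (ln_star x)) at_top"
    by (auto simp: eventually_at_top_linorder)
qed


lemma filterlim_powr_at_top:
  fixes a :: real
  assumes "a > 0"
  shows "filterlim (\<lambda>x. x powr a) at_top at_top"
proof (rule filterlim_mono_eventually[where F' = at_top and F = at_top])
  show "filterlim (\<lambda>x. exp (a * ln x)) at_top at_top"
    using assms ln_at_top
    by (intro filterlim_compose[OF exp_at_top] filterlim_tendsto_pos_mult_at_top[OF tendsto_const])
  show "\<forall>\<^sub>F x in at_top. exp (a * ln x) = x powr a"
    using eventually_gt_at_top[of 0] by eventually_elim (simp add: powr_def)
qed auto

text \<open>Here \<open>x\<close> stands for the argument of \<open>ln_star\<close>, later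
  \<open>n / \<phi>(n) * ln q\<close>. Keeping it free makes \<open>n0\<close> and \<open>c\<close>
  independent of \<open>\<phi>\<close>.\<close>

lemma num_rich_le_powr:
  fixes lam \<gamma> :: real
  assumes A: "finite A" "card A \<ge> 2"
    and lam: "1 / 2 < lam" "lam < 1" and \<gamma>: "\<gamma> > 1"
  obtains n0 :: nat and c :: real where "n0 \<ge> 1" "c > 0"
    "\<And>n x. n > n0 \<Longrightarrow> x \<le> real n * ln (card A) \<Longrightarrow>
      real (num_rich A n)
        \<le> card A powr (real n / (2 * lam) powr ((c * real (ln_star x)) powr (1 / \<gamma>) - 1))"
proof -
  define s0 where "s0 = ln (card A)"
  have s0: "s0 > 0" using A by (simp add: s0_def)
  define M where "M = max 14080 (max s0 (1 / s0))"
  have M: "M \<ge> 14080" "M \<ge> s0" "M \<ge> 1 / s0" by (auto simp: M_def)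
  let ?t = "exp_tower M"
  \<comment> \<open>Chosen so that \<open>ln_star x \<le> (8 + ln_star M) * k\<close> gives
    \<open>c * ln_star x \<le> k / 6\<close>.\<close>
  define c where "c = 1 / (6 * (8 + real (ln_star M)))"
  \<comment> \<open>Level 7 ensures \<open>k \<ge> 6\<close> below, hence
    \<open>k / 6 \<ge> 1\<close>.\<close>
  define n0 where "n0 = nat \<lceil>?t 7\<rceil>"
  have t_ge: "?t k \<ge> M" for k using exp_tower_ge[of M k] by simp
  have "real (num_rich A n)
      \<le> card A powr (real n / (2 * lam) powr ((c * real (ln_star x)) powr (1 / \<gamma>) - 1))"
    if n: "n > n0" and x: "x \<le> real n * ln (card A)" for n x
  proof -
    have t7: "?t 7 \<le> real n" using n unfolding n0_def by linarith
    define j where "j = (LEAST j. real n < ?t j)"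
    have "real n < ?t n" using exp_tower_ge[of M n] M by simp
    then have j: "real n < ?t j" unfolding j_def by (rule LeastI)
    have "j > 7"
    proof (rule ccontr)
      assume "\<not> j > 7"
      then show False using exp_tower_mono[of j 7 M] j t7 by simp
    qed
    \<comment> \<open>Now \<open>?t (k + 1) \<le> n < ?t (k + 2)\<close>. The lower bound makes the
      constant \<open>?t k\<close> negligible against \<open>s * n\<close>; the upper bound makes
      \<open>ln_star x\<close> at most proportional to \<open>k\<close>.\<close>
    define k where "k = j - 2"
    have k: "k \<ge> 6" "j = Suc (Suc k)" using \<open>j > 7\<close> by (auto simp: k_def)
    have tk: "?t (Suc k) \<le> real n"
      using not_less_Least[of "Suc k" "\<lambda>j. real n < ?t j"] k by (simp add: j_def not_less)
    define s where "s = s0 * (7/8) ^ k"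
    have s: "s > 0" using s0 by (simp add: s_def)
    have "1 / s \<le> ?t k"
      using num_rich_le_exp_tower(1)[OF A M[unfolded s0_def]] by (simp add: s_def s0_def)
    then have "1 \<le> ?t k * s" using s by (simp add: field_simps)
    then have "?t k * 1 \<le> ?t k * (?t k * s)"
      using t_ge[of k] M by (intro mult_left_mono) auto
    also have "\<dots> = ?t k ^ 2 * s" by (simp add: power2_eq_square)
    also have "\<dots> \<le> real n * s"
    proof (rule mult_right_mono)
      show "?t k ^ 2 \<le> real n"
        using square_le_exp_exp[of "?t k"] t_ge[of k] M tk by simp
    qed (use s in simp)
    finally have tks: "?t k \<le> s * real n" by (simp add: mult.commute)
    have "real (num_rich A n) \<le> exp (?t k + s * real n)"
      using num_rich_le_exp_tower(2)[OF A M[unfolded s0_def]] by (simp add: s_def s0_def)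
    \<comment> \<open>Absorbing \<open>?t k\<close> into \<open>s * n\<close> costs the factor 2,
      which the \<open>- 1\<close> in the exponent of \<open>2 * lam\<close> pays for later.\<close>
    also have "\<dots> \<le> exp (s0 * (real n * (2 * (7/8) ^ k)))"
      using tks by (simp add: s_def algebra_simps)
    also have "\<dots> = card A powr (real n * (2 * (7/8) ^ k))"
      using A by (auto simp: powr_def s0_def mult.commute)
    also have "\<dots> \<le> card A powr (real n / (2 * lam) powr ((c * real (ln_star x)) powr (1 / \<gamma>) - 1))"
    proof (rule powr_mono)
      let ?y = "c * real (ln_star x)"
      \<comment> \<open>Both \<open>n\<close> and \<open>s0\<close> are at most
        \<open>?t (k + 2)\<close>, and one further level absorbs the square.\<close>
      have "x \<le> ?t (Suc (Suc k)) * ?t (Suc (Suc k))"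
      proof -
        have "real n * s0 \<le> ?t (Suc (Suc k)) * ?t (Suc (Suc k))"
          using j k M t_ge[of "Suc (Suc k)"] s0 by (intro mult_mono) auto
        then show ?thesis using x by (simp add: s0_def)
      qed
      also have "\<dots> \<le> ?t (Suc (Suc (Suc k)))"
        using square_le_exp_exp[of "?t (Suc (Suc k))"] t_ge[of "Suc (Suc k)"] M
        by (simp add: power2_eq_square)
      finally have "ln_star x \<le> 2 * (k + 3) + ln_star M"
        using ln_star_mono[of x "?t (k + 3)"] ln_star_exp_tower[of M "k + 3"] M
        by (simp add: numeral_3_eq_3)
      then have "real (ln_star x) \<le> real (2 * (k + 3) + ln_star M)"
        by (simp only: of_nat_le_iff)
      then have "real (ln_star x) \<le> 2 * real k + (6 + real (ln_star M))"
        by simp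
      also have "\<dots> \<le> 2 * real k + (6 + real (ln_star M)) * real k"
        using k by (simp add: mult_le_cancel_left1)
      finally have "real (ln_star x) \<le> (8 + real (ln_star M)) * real k"
        by (simp add: algebra_simps)
      then have y: "0 \<le> ?y" "?y \<le> real k / 6"
        by (simp_all add: c_def field_simps)
      have "?y powr (1 / \<gamma>) \<le> (real k / 6) powr (1 / \<gamma>)"
        using y \<gamma> by (intro powr_mono2) auto
      \<comment> \<open>Since \<open>k / 6 \<ge> 1\<close> and \<open>1 / \<gamma> < 1\<close>, the
        root may be dropped.\<close>
      also have "\<dots> \<le> (real k / 6) powr 1"
        using k \<gamma> by (intro powr_mono) auto
      finally have "?y powr (1 / \<gamma>) \<le> real k / 6"
        using k by simp
      then have "(2 * lam) powr (?y powr (1 / \<gamma>) - 1) \<le> (2 * lam) powr (real k / 6 - 1)"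
        using lam by (intro powr_mono) auto
      also have "\<dots> \<le> 2 powr (real k / 6 - 1)"
        using lam k by (intro powr_mono2) auto
      also have "\<dots> = 2 powr (real k / 6) / 2"
        by (simp add: powr_diff)
      \<comment> \<open>The 6 comes from \<open>2 \<le> (8/7) ^ 6\<close>: six improvement steps at
        least halve the rate.\<close>
      also have "\<dots> \<le> ((8/7) ^ 6) powr (real k / 6) / 2"
        by (intro divide_right_mono powr_mono2) (auto simp: power_divide)
      also have "\<dots> = ((8/7) powr 6) powr (real k / 6) / 2"
        by simp
      also have "\<dots> = (8/7) ^ k / 2"
        by (simp only: powr_powr) (simp add: powr_realpow)
      finally have "(2 * lam) powr (?y powr (1 / \<gamma>) - 1) \<le> (8/7) ^ k / 2" .
      then have "real n / ((8/7) ^ k / 2) \<le> real n / (2 * lam) powr (?y powr (1 / \<gamma>) - 1)"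
        using lam by (intro divide_left_mono) auto
      then show "real n * (2 * (7/8) ^ k) \<le> real n / (2 * lam) powr (?y powr (1 / \<gamma>) - 1)"
        by (simp add: power_divide mult.commute)
    qed (use A in simp)
    finally show ?thesis .
  qed
  moreover have "n0 \<ge> 1"
    using t_ge[of 7] M by (simp add: n0_def Suc_le_eq)
  moreover have "c > 0" by (simp add: c_def)
  ultimately show ?thesis using that by blast
qed

section \<open>The bound by \<open>B\<close> and the limit of its roots\<close>

theorem theorem18:
  fixes A :: "'a set" and q :: nat and lam \<gamma> :: real and \<phi> :: "real \<Rightarrow> real"
  assumes "finite A" and "card A = q" and "q \<ge> 1"
    and "1 / 2 < lam" and "lam < 1"
    and "\<gamma> > 1"
    and "\<phi> \<in> Phi"
  shows "\<exists>(n0 :: nat) (c :: real). n0 \<ge> 1 \<and> c > 0 \<and>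
    (let f = (\<lambda>n :: nat. (c * real (ln_star (real n / \<phi> (real n) * ln (real q)))) powr (1 / \<gamma>));
         B = (\<lambda>n :: nat. real q powr
                (real n / \<phi> (real n) + real n / ((2 * lam) powr (f n - 1))))
     in (\<forall>n > n0. real (num_rich A n) \<le> B n) \<and>
        (\<exists>L \<le> 1. (\<lambda>n. root n (B n)) \<longlonglongrightarrow> L))"
proof (cases "q = 1")
  case True
  have "num_rich A n \<le> 1" for n
    using num_rich_le_power[of A n] assms True by simp
  moreover have "(\<lambda>n. root n 1) \<longlonglongrightarrow> (1 :: real)"
  proof (rule tendsto_eventually)
    \<comment> \<open>Only eventually, because \<open>root 0 1\<close> is 0 by convention.\<close>
    show "\<forall>\<^sub>F n in sequentially. root n 1 = (1 :: real)"
      using eventually_gt_at_top[of 0] by eventually_elim simp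
  qed
  ultimately show ?thesis
    using True by (intro exI[of _ 1]) (auto intro!: exI[of _ "1::real"])
next
  case False
  then have q: "card A \<ge> 2" "q \<ge> 2" using assms by auto
  obtain n0 :: nat and c :: real where n0: "n0 \<ge> 1" and c: "c > 0" and
    bound: "\<And>n x. n > n0 \<Longrightarrow> x \<le> real n * ln (card A) \<Longrightarrow>
      real (num_rich A n)
        \<le> card A powr (real n / (2 * lam) powr ((c * real (ln_star x)) powr (1 / \<gamma>) - 1))"
    using num_rich_le_powr[OF assms(1) q(1) assms(4-6)] by blast
  define f where "f = (\<lambda>n :: nat. (c * real (ln_star (real n / \<phi> (real n) * ln (real q)))) powr (1 / \<gamma>))"
  define B where "B = (\<lambda>n :: nat. real q powr
                (real n / \<phi> (real n) + real n / ((2 * lam) powr (f n - 1))))"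
  have \<phi>1: "\<phi> x \<ge> 1" if "x \<ge> 1" for x
    using assms(7) that by (auto simp: Phi_def Delta_def)
  have lnq: "ln (real q) > 0" using q by simp
  have "real (num_rich A n) \<le> B n" if n: "n > n0" for n
  proof -
    have \<phi>n: "\<phi> (real n) \<ge> 1" using n n0 by (intro \<phi>1) simp
    have "real n / \<phi> (real n) \<le> real n / 1"
      using \<phi>n by (intro divide_left_mono) auto
    then have "real n / \<phi> (real n) * ln (real q) \<le> real n * ln (card A)"
      using assms(2) lnq by (intro mult_mono) auto
    then have "real (num_rich A n) \<le> real q powr (real n / ((2 * lam) powr (f n - 1)))"
      using bound[OF n] assms(2) by (simp add: f_def)
    also have "\<dots> \<le> B n"
      unfolding B_def using \<phi>n q by (intro powr_mono) auto
    finally show ?thesis .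
  qed
  moreover have "(\<lambda>n. root n (B n)) \<longlonglongrightarrow> 1"
  proof -
    \<comment> \<open>The \<open>n\<close>-th root divides the exponent of \<open>B n\<close> by
      \<open>n\<close>, leaving \<open>1 / \<phi>(n)\<close> and the reciprocal of
      \<open>(2 * lam) powr (f n - 1)\<close>. Both vanish in the limit, the latter because
      \<open>f\<close> tends to infinity and \<open>2 * lam > 1\<close>.\<close>
    have "filterlim (\<lambda>n :: nat. real n / \<phi> (real n)) at_top sequentially"
      using assms(7) filterlim_real_sequentially by (auto simp: Phi_def intro: filterlim_compose)
    then have "filterlim (\<lambda>n :: nat. real n / \<phi> (real n) * ln (real q)) at_top sequentially"
      using lnq by (intro filterlim_at_top_mult_tendsto_pos[OF tendsto_const])
    then have "filterlim (\<lambda>n :: nat. real (ln_star (real n / \<phi> (real n) * ln (real q)))) at_top sequentially"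
      by (rule filterlim_compose[OF filterlim_ln_star])
    then have "filterlim (\<lambda>n :: nat. c * real (ln_star (real n / \<phi> (real n) * ln (real q)))) at_top sequentially"
      using c by (intro filterlim_tendsto_pos_mult_at_top[OF tendsto_const])
    then have "filterlim f at_top sequentially"
      unfolding f_def using assms(6)
      by (intro filterlim_compose[OF filterlim_powr_at_top]) auto
    then have "filterlim (\<lambda>n. - 1 + f n) at_top sequentially"
      by (intro filterlim_tendsto_add_at_top[OF tendsto_const])
    then have "filterlim (\<lambda>n. ln (2 * lam) * (- 1 + f n)) at_top sequentially"
      using assms(4) by (intro filterlim_tendsto_pos_mult_at_top[OF tendsto_const]) auto
    then have "filterlim (\<lambda>n. exp (ln (2 * lam) * (- 1 + f n))) at_top sequentially"
      by (rule filterlim_compose[OF exp_at_top])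
    then have "(\<lambda>n. inverse (exp (ln (2 * lam) * (- 1 + f n)))) \<longlonglongrightarrow> 0"
      by (rule tendsto_inverse_0_at_top)
    moreover have "(\<lambda>n :: nat. inverse (\<phi> (real n))) \<longlonglongrightarrow> 0"
      using assms(7) filterlim_real_sequentially
      by (intro tendsto_inverse_0_at_top) (auto simp: Phi_def Delta_def intro: filterlim_compose)
    ultimately have "(\<lambda>n. real q powr (inverse (\<phi> (real n)) + inverse (exp (ln (2 * lam) * (- 1 + f n)))))
        \<longlonglongrightarrow> real q powr (0 + 0)"
      using q by (intro tendsto_powr tendsto_add tendsto_const) auto
    then have "(\<lambda>n. real q powr (inverse (\<phi> (real n)) + inverse (exp (ln (2 * lam) * (- 1 + f n)))))
        \<longlonglongrightarrow> 1"
      using q by simp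
    moreover have "\<forall>\<^sub>F n in sequentially. real q powr (inverse (\<phi> (real n)) + inverse (exp (ln (2 * lam) * (- 1 + f n))))
        = root n (B n)"
      using eventually_gt_at_top[of 0]
    proof eventually_elim
      case (elim n)
      have "root n (B n) = B n powr (1 / real n)"
        using elim by (simp add: root_powr_inverse B_def)
      also have "\<dots> = real q powr (inverse (\<phi> (real n)) + inverse ((2 * lam) powr (f n - 1)))"
        using elim by (simp add: B_def powr_powr add_divide_distrib inverse_eq_divide)
      finally show ?case
        using assms(4) by (simp add: powr_def mult.commute)
    qed
    ultimately show ?thesis by (rule Lim_transform_eventually)
  qed
  ultimately show ?thesis
    using n0 c by (intro exI[of _ n0] exI[of _ c]) (auto simp: Let_def f_def B_def)
qed

end
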